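(* Let $K_0,\dots,K_n$ be strictly concave kernel functions. Then for each simplex $S=S_\sigma$ there exists an equioscillation point in $\overline{S}$. Moreover, if either all the kernels belong to $\mathrm{C}^1(0,2\pi)$ or at least $n$ of them satisfy condition $(\infty')$, then every equioscillation point in $\overline{S}$ belongs to the open simplex $S$.
   Context: Identify the torus $\mathbb{T}=\mathbb{R}/2\pi\mathbb{Z}$ with $[0,2\pi)$. A concave kernel function is a $2\pi$-periodic function $K:\mathbb{R}\to[-\infty,\infty)$ which is real-valued and concave on $(0,2\pi)$ and such that $\lim_{t\downarrow0}K(t)$ and $\lim_{t\uparrow2\pi}K(t)$ exist in $[-\infty,\infty)$ and are equal; it is strictly concave if strictly concave on $(0,2\pi)$. Condition $(\infty')$: either $\lim_{t\uparrow2\pi}D_-K(t)=\lim_{t\uparrow2\pi}D_+K(t)=-\infty$, or $\lim_{t\downarrow0}D_-K(t)=\lim_{t\downarrow0}D_+K(t)=+\infty$ ($D_\pm$ one-sided derivatives). For $\mathbf{y}=(y_1,\dots,y_n)\in\mathbb{T}^n$ put $y_0=0$, $y_{n+1}=2\pi$ and $F(\mathbf{y},t)=K_0(t)+\sum_{j=1}^nK_j(t-y_j)$. For a permutation $\sigma$ of $\{1,\dots,n\}$ with $\sigma(0)=0,\sigma(n+1)=n+1$, $S_\sigma=\{\mathbf{y}:0<y_{\sigma(1)}<\dots<y_{\sigma(n)}<2\pi\}$, $\overline{S_\sigma}$ the set where $0\le y_{\sigma(1)}\le\dots\le y_{\sigma(n)}\le2\pi$; for $\mathbf{y}\in\overline{S_\sigma}$,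 $I_{\sigma(k)}(\mathbf{y})=[y_{\sigma(k)},y_{\sigma(k+1)}]$ and $m_{\sigma(k)}(\mathbf{y})=\sup_{t\in I_{\sigma(k)}(\mathbf{y})}F(\mathbf{y},t)$, $k=0,\dots,n$. A point $\mathbf{y}\in\overline{S_\sigma}$ is an equioscillation point if $m_0(\mathbf{y})=\dots=m_n(\mathbf{y})$.
   Formalization: Each kernel is additionally required to satisfy K(0) = lim_{t↓0}K(t) = lim_{t↑2π}K(t); with an arbitrary value at 0 the claim fails (a large K_1(0) makes y_1 = 0 an equioscillation point outside S). *)

theory Defs
  imports "HOL-Analysis.Analysis" "HOL-Library.Extended_Real" "HOL-Combinatorics.Permutations"
begin

definition strictly_concave_on :: "real set \<Rightarrow> (real \<Rightarrow> real) \<Rightarrow> bool" where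
  "strictly_concave_on S f \<longleftrightarrow> convex S \<and>
     (\<forall>x\<in>S. \<forall>y\<in>S. x \<noteq> y \<longrightarrow> (\<forall>u::real. 0 < u \<and> u < 1 \<longrightarrow>
        f (u * x + (1 - u) * y) > u * f x + (1 - u) * f y))"

definition kernel_base :: "(real \<Rightarrow> ereal) \<Rightarrow> bool" where
  "kernel_base K \<longleftrightarrow>
     (\<forall>t. K (t + 2 * pi) = K t) \<and>
     (\<forall>t. K t \<noteq> \<infinity>) \<and>
     (\<forall>t\<in>{0<..<2 * pi}. K t \<noteq> - \<infinity>) \<and>
     (\<exists>L. L \<noteq> \<infinity> \<and> (K \<longlongrightarrow> L) (at_right 0) \<and> (K \<longlongrightarrow> L) (at_left (2 * pi)) \<and> K 0 = L)"

definition concave_kernel :: "(real \<Rightarrow> ereal) \<Rightarrow> bool" where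
  "concave_kernel K \<longleftrightarrow> kernel_base K \<and> concave_on {0<..<2 * pi} (\<lambda>t. real_of_ereal (K t))"

definition strictly_concave_kernel :: "(real \<Rightarrow> ereal) \<Rightarrow> bool" where
  "strictly_concave_kernel K \<longleftrightarrow> kernel_base K \<and>
     strictly_concave_on {0<..<2 * pi} (\<lambda>t. real_of_ereal (K t))"

definition right_deriv :: "(real \<Rightarrow> real) \<Rightarrow> real \<Rightarrow> real" where
  "right_deriv f t = Lim (at_right 0) (\<lambda>h. (f (t + h) - f t) / h)"

definition left_deriv :: "(real \<Rightarrow> real) \<Rightarrow> real \<Rightarrow> real" where
  "left_deriv f t = Lim (at_left 0) (\<lambda>h. (f (t + h) - f t) / h)"

definition cond_infty' :: "(real \<Rightarrow> ereal) \<Rightarrow> bool" where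
  "cond_infty' K \<longleftrightarrow>
     (let k = (\<lambda>t. real_of_ereal (K t)) in
       (filterlim (left_deriv k) at_bot (at_left (2 * pi)) \<and>
        filterlim (right_deriv k) at_bot (at_left (2 * pi)))
     \<or> (filterlim (left_deriv k) at_top (at_right 0) \<and>
        filterlim (right_deriv k) at_top (at_right 0)))"

definition kernel_C1 :: "(real \<Rightarrow> ereal) \<Rightarrow> bool" where
  "kernel_C1 K \<longleftrightarrow> (\<lambda>t. real_of_ereal (K t)) C1_differentiable_on {0<..<2 * pi}"

definition sot :: "nat \<Rightarrow> (nat \<Rightarrow> real \<Rightarrow> ereal) \<Rightarrow> (nat \<Rightarrow> real) \<Rightarrow> real \<Rightarrow> ereal" where
  "sot n K y t = K 0 t + (\<Sum>j\<in>{1..n}. K j (t - y j))"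

definition ynode :: "nat \<Rightarrow> (nat \<Rightarrow> real) \<Rightarrow> nat \<Rightarrow> real" where
  "ynode n y j = (if j = 0 then 0 else if j = n + 1 then 2 * pi else y j)"

definition open_simplex :: "nat \<Rightarrow> (nat \<Rightarrow> nat) \<Rightarrow> (nat \<Rightarrow> real) set" where
  "open_simplex n \<sigma> = {y. \<forall>k\<le>n. ynode n y (\<sigma> k) < ynode n y (\<sigma> (k + 1))}"

definition closed_simplex :: "nat \<Rightarrow> (nat \<Rightarrow> nat) \<Rightarrow> (nat \<Rightarrow> real) set" where
  "closed_simplex n \<sigma> = {y. \<forall>k\<le>n. ynode n y (\<sigma> k) \<le> ynode n y (\<sigma> (k + 1))}"

definition interval_max :: "nat \<Rightarrow> (nat \<Rightarrow> real \<Rightarrow> ereal) \<Rightarrow> (nat \<Rightarrow> nat) \<Rightarrow> (nat \<Rightarrow> real) \<Rightarrow> nat \<Rightarrow> ereal" where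
  "interval_max n K \<sigma> y k =
     (SUP t\<in>{ynode n y (\<sigma> k) .. ynode n y (\<sigma> (k + 1))}. sot n K y t)"

definition equioscillation_point :: "nat \<Rightarrow> (nat \<Rightarrow> real \<Rightarrow> ereal) \<Rightarrow> (nat \<Rightarrow> nat) \<Rightarrow> (nat \<Rightarrow> real) \<Rightarrow> bool" where
  "equioscillation_point n K \<sigma> y \<longleftrightarrow> y \<in> closed_simplex n \<sigma> \<and>
     (\<forall>k\<le>n. interval_max n K \<sigma> y k = interval_max n K \<sigma> y 0)"

end

theory Submission
  imports Defs
begin

text \<open>
  Existence. Parametrise the closed simplex by the unit cube through stick breaking: the last node
  is a fraction of \<open>2\<pi>\<close>, and each earlier node is a fraction of its successor. On the face where
  the \<open>i\<close>-th fraction is 0 the interval ending at the \<open>i\<close>-th node collapses, and on the opposite face the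
  interval starting there does. A collapsed interval is an endpoint of its neighbour and so has the
  smaller maximum. The Poincare-Miranda theorem then gives a point where all adjacent maxima agree.
  It is derived from Kuhn's combinatorial lemma because the dimension \<open>n\<close> is a term, not a type.

  Location. If an equioscillation point has a collapsed interval at \<open>a\<close>, then \<open>F(y, a)\<close> is the finite
  global maximum of \<open>F(y, \<cdot>)\<close>, and two distinct kernels are centred at \<open>a\<close>. A strictly concave
  kernel with finite value at its centre has a cusp there pointing down: the one-sided difference quotients
  in both directions away from the centre are bounded below by a positive constant. In the smooth case
  the remaining kernels contribute 0 to the symmetric second difference quotient; under condition
  \<open>(\<infinity>')\<close> for one of the two centred kernels a one-sided quotient tends to infinity while the others stay
  bounded below. Both contradict maximality at \<open>a\<close>.
\<close>

section \<open>The Poincare-Miranda theorem\<close>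

lemma tendsto_fun_iff:
  fixes X :: "'a \<Rightarrow> 'b \<Rightarrow> 'c::topological_space"
  shows "(X \<longlongrightarrow> l) F \<longleftrightarrow> (\<forall>j. ((\<lambda>p. X p j) \<longlongrightarrow> l j) F)"
proof -
  have "(X \<longlongrightarrow> l) F \<longleftrightarrow> limitin (product_topology (\<lambda>_. euclidean) UNIV) X l F"
    by (simp add: euclidean_product_topology)
  then show ?thesis
    by (simp add: limitin_componentwise)
qed

text \<open>Tychonoff. Points have infinitely many coordinates because they are functions on the
  naturals; the dimension \<open>n\<close> enters later, as the number of equations.\<close>

lemma compact_unit_cube: "compact {s :: nat \<Rightarrow> real. \<forall>j. s j \<in> {0..1}}"
proof -
  have "compactin (product_topology (\<lambda>_::nat. euclidean :: real topology) UNIV) (PiE UNIV (\<lambda>_. {0..1}))"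
    by (simp add: compactin_PiE)
  moreover have "PiE UNIV (\<lambda>_. {0..1}) = {s :: nat \<Rightarrow> real. \<forall>j. s j \<in> {0..1}}"
    by (auto simp: PiE_iff)
  ultimately show ?thesis
    by (simp add: euclidean_product_topology)
qed

text \<open>Discrete Poincare-Miranda: Kuhn's lemma on the grid of mesh \<open>1 / p\<close>, with
  labels recording which of \<open>u i\<close> and \<open>v i\<close> is larger. The two families
  are compared, not subtracted, because they will take values in the extended reals.\<close>

lemma grid_sign_change:
  fixes u v :: "nat \<Rightarrow> (nat \<Rightarrow> real) \<Rightarrow> 'a::linorder"
  assumes lo: "\<And>i s. i < n \<Longrightarrow> \<forall>j. s j \<in> {0..1} \<Longrightarrow> s i = 0 \<Longrightarrow> u i s \<le> v i s"
    and hi: "\<And>i s. i < n \<Longrightarrow> \<forall>j. s j \<in> {0..1} \<Longrightarrow> s i = 1 \<Longrightarrow> v i s \<le> u i s"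
    and p: "0 < p"
  shows "\<exists>q. (\<forall>j. q j \<in> {0..1}) \<and> (\<forall>i<n. \<exists>r s. (\<forall>j. \<bar>r j - q j\<bar> \<le> 1 / real p) \<and>
           (\<forall>j. \<bar>s j - q j\<bar> \<le> 1 / real p) \<and> u i r \<le> v i r \<and> v i s \<le> u i s)"
proof -
  \<comment> \<open>Coordinates from \<open>n\<close> on are frozen at 0, so that embedded grid
    points lie in the infinite cube.\<close>
  define emb where "emb x = (\<lambda>j. if j < n then real (x j) / real p else 0)" for x :: "nat \<Rightarrow> nat"
  \<comment> \<open>Kuhn's lemma requires label 0 on each lower face and 1 on each upper face. The
    boundary hypotheses guarantee that these forced labels still certify a true weak
    inequality.\<close>
  define label where "label x i = (if x i = 0 then 0 else if x i = p then 1
      else if u i (emb x) \<le> v i (emb x) then 0 else 1 :: nat)" for x i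
  have emb_cube: "\<forall>j. emb x j \<in> {0..1}" if "\<forall>i<n. x i \<le> p" for x
    using that p by (auto simp: emb_def)
  have label0: "u i (emb x) \<le> v i (emb x)" if "\<forall>i<n. x i \<le> p" "i < n" "label x i = 0" for x i
    using that lo[OF that(2) emb_cube[OF that(1)]]
    by (auto simp: label_def emb_def split: if_splits)
  have label1: "v i (emb x) \<le> u i (emb x)" if "\<forall>i<n. x i \<le> p" "i < n" "label x i \<noteq> 0" for x i
    using that hi[OF that(2) emb_cube[OF that(1)]] p
    by (auto simp: label_def emb_def split: if_splits)
  obtain q where q: "\<forall>i<n. q i < p"
    and rs: "\<forall>i<n. \<exists>r s. (\<forall>j<n. q j \<le> r j \<and> r j \<le> q j + 1) \<and>
        (\<forall>j<n. q j \<le> s j \<and> s j \<le> q j + 1) \<and> label r i \<noteq> label s i"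
    by (rule kuhn_lemma[of p n label]) (use p in \<open>auto simp: label_def\<close>)
  have near: "\<forall>j. \<bar>emb r j - emb q j\<bar> \<le> 1 / real p"
    if "\<forall>j<n. q j \<le> r j \<and> r j \<le> q j + 1" for r
  proof
    fix j
    have "\<bar>real (r j) - real (q j)\<bar> \<le> 1" if "j < n"
      using \<open>\<forall>j<n. q j \<le> r j \<and> r j \<le> q j + 1\<close>[rule_format, OF that] by linarith
    then show "\<bar>emb r j - emb q j\<bar> \<le> 1 / real p"
      using p by (auto simp: emb_def divide_right_mono simp flip: diff_divide_distrib)
  qed
  have box: "\<forall>i<n. r i \<le> p" if "\<forall>j<n. q j \<le> r j \<and> r j \<le> q j + 1" for r
    using that q by fastforce
  show ?thesis
  proof (rule exI[of _ "emb q"], intro conjI allI impI)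
    show "emb q j \<in> {0..1}" for j using emb_cube[of q] q by (auto simp: less_imp_le)
  next
    fix i assume i: "i < n"
    then obtain r s where r: "\<forall>j<n. q j \<le> r j \<and> r j \<le> q j + 1"
      and s: "\<forall>j<n. q j \<le> s j \<and> s j \<le> q j + 1" and ne: "label r i \<noteq> label s i"
      using rs by blast
    show "\<exists>r s. (\<forall>j. \<bar>r j - emb q j\<bar> \<le> 1 / real p) \<and>
           (\<forall>j. \<bar>s j - emb q j\<bar> \<le> 1 / real p) \<and> u i r \<le> v i r \<and> v i s \<le> u i s"
    proof (cases "label r i = 0")
      case True
      with ne have "label s i \<noteq> 0" by simp
      with True show ?thesis
        using near[OF r] near[OF s] label0[OF box[OF r] i] label1[OF box[OF s] i] by blast
    next
      case False
      with ne have "label s i = 0" by (auto simp: label_def split: if_splits)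
      with False show ?thesis
        using near[OF r] near[OF s] label1[OF box[OF r] i] label0[OF box[OF s] i] by blast
    qed
  qed
qed

text \<open>As the mesh shrinks, a subsequence of grid cells contracts to one point of the cube. For
  each \<open>i\<close> the cells supply witnesses of both weak inequalities, and by continuity both
  survive in the limit.\<close>

theorem poincare_miranda:
  fixes u v :: "nat \<Rightarrow> (nat \<Rightarrow> real) \<Rightarrow> 'a::linorder_topology"
  assumes cont: "\<And>i. i < n \<Longrightarrow> continuous_on UNIV (u i)" "\<And>i. i < n \<Longrightarrow> continuous_on UNIV (v i)"
    and lo: "\<And>i s. i < n \<Longrightarrow> \<forall>j. s j \<in> {0..1} \<Longrightarrow> s i = 0 \<Longrightarrow> u i s \<le> v i s"
    and hi: "\<And>i s. i < n \<Longrightarrow> \<forall>j. s j \<in> {0..1} \<Longrightarrow> s i = 1 \<Longrightarrow> v i s \<le> u i s"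
  shows "\<exists>s. (\<forall>j. s j \<in> {0..1}) \<and> (\<forall>i<n. u i s = v i s)"
proof -
  have "\<forall>p. \<exists>q. (\<forall>j. q j \<in> {0..1}) \<and> (\<forall>i<n. \<exists>r s. (\<forall>j. \<bar>r j - q j\<bar> \<le> 1 / real (Suc p)) \<and>
           (\<forall>j. \<bar>s j - q j\<bar> \<le> 1 / real (Suc p)) \<and> u i r \<le> v i r \<and> v i s \<le> u i s)"
    by (intro allI grid_sign_change[where u = u and v = v]) (use lo hi in auto)
  then obtain q where q: "\<And>p. \<forall>j. q p j \<in> {0..1}"
    and ex: "\<And>p. \<forall>i<n. \<exists>r s. (\<forall>j. \<bar>r j - q p j\<bar> \<le> 1 / real (Suc p)) \<and>
           (\<forall>j. \<bar>s j - q p j\<bar> \<le> 1 / real (Suc p)) \<and> u i r \<le> v i r \<and> v i s \<le> u i s"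
    by metis
  \<comment> \<open>The index type is countable, so the product topology is metrizable and
    compactness yields convergent subsequences.\<close>
  have "seq_compact {s :: nat \<Rightarrow> real. \<forall>j. s j \<in> {0..1}}"
    using compact_unit_cube by (simp add: compact_eq_seq_compact_metric)
  then obtain l \<phi> where l: "\<forall>j. l j \<in> {0..1}" and \<phi>: "strict_mono \<phi>" and lim: "(q \<circ> \<phi>) \<longlonglongrightarrow> l"
    using q by (auto elim!: seq_compactE[where f = q])
  have near_lim: "r \<longlonglongrightarrow> l" if r: "\<And>p j. \<bar>r p j - q (\<phi> p) j\<bar> \<le> 1 / real (Suc (\<phi> p))" for r
    unfolding tendsto_fun_iff
  proof
    fix j
    have "(\<lambda>p. q (\<phi> p) j) \<longlonglongrightarrow> l j"
      using lim by (simp add: tendsto_fun_iff o_def)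
    moreover have "(\<lambda>p. 1 / real (Suc (\<phi> p))) \<longlonglongrightarrow> 0"
      using LIMSEQ_subseq_LIMSEQ[OF LIMSEQ_inverse_real_of_nat \<phi>]
      by (simp add: o_def inverse_eq_divide)
    then have "(\<lambda>p. r p j - q (\<phi> p) j) \<longlonglongrightarrow> 0"
      by (rule Lim_null_comparison[rotated]) (use r in auto)
    ultimately have "(\<lambda>p. (r p j - q (\<phi> p) j) + q (\<phi> p) j) \<longlonglongrightarrow> 0 + l j"
      by (intro tendsto_add)
    then show "(\<lambda>p. r p j) \<longlonglongrightarrow> l j" by simp
  qed
  have "u i l = v i l" if i: "i < n" for i
  proof -
    have "\<forall>p. \<exists>r s. (\<forall>j. \<bar>r j - q (\<phi> p) j\<bar> \<le> 1 / real (Suc (\<phi> p))) \<and>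
           (\<forall>j. \<bar>s j - q (\<phi> p) j\<bar> \<le> 1 / real (Suc (\<phi> p))) \<and> u i r \<le> v i r \<and> v i s \<le> u i s"
      using ex i by blast
    then obtain r s where r: "\<And>p j. \<bar>r p j - q (\<phi> p) j\<bar> \<le> 1 / real (Suc (\<phi> p))"
      and s: "\<And>p j. \<bar>s p j - q (\<phi> p) j\<bar> \<le> 1 / real (Suc (\<phi> p))"
      and ur: "\<And>p. u i (r p) \<le> v i (r p)" and vs: "\<And>p. v i (s p) \<le> u i (s p)"
      by metis
    have c: "isCont (u i) l" "isCont (v i) l"
      using cont[OF i] by (auto simp: continuous_on_eq_continuous_at)
    have "u i l \<le> v i l"
      using isCont_tendsto_compose[OF c(1) near_lim[OF r]] isCont_tendsto_compose[OF c(2) near_lim[OF r]]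
      by (rule LIMSEQ_le) (use ur in auto)
    moreover have "v i l \<le> u i l"
      using isCont_tendsto_compose[OF c(2) near_lim[OF s]] isCont_tendsto_compose[OF c(1) near_lim[OF s]]
      by (rule LIMSEQ_le) (use vs in auto)
    ultimately show ?thesis by simp
  qed
  with l show ?thesis by blast
qed

section \<open>Continuity of kernels and interval maxima\<close>

text \<open>Berge's maximum theorem for a fixed compact set. A single point with a large value
  bounds the supremum from below nearby; the tube lemma bounds it from above uniformly.\<close>

lemma continuous_on_SUP_compact:
  fixes g :: "'a::topological_space \<Rightarrow> 'b::topological_space \<Rightarrow> ereal"
  assumes S: "compact S" "S \<noteq> {}"
    and cont: "continuous_on (UNIV \<times> S) (\<lambda>(x, s). g x s)"
  shows "continuous_on UNIV (\<lambda>x. SUP s\<in>S. g x s)"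
  unfolding continuous_on_def
proof
  fix x :: 'a
  show "((\<lambda>x. SUP s\<in>S. g x s) \<longlongrightarrow> (SUP s\<in>S. g x s)) (at x within UNIV)"
  proof (rule order_tendstoI)
    fix a assume "a < (SUP s\<in>S. g x s)"
    then obtain s where s: "s \<in> S" "a < g x s" by (auto simp: less_SUP_iff)
    have "continuous_on UNIV (\<lambda>x. case (x, s) of (x, s) \<Rightarrow> g x s)"
      by (rule continuous_on_compose2[OF cont]) (use s in \<open>auto intro!: continuous_intros\<close>)
    then have "((\<lambda>x. g x s) \<longlongrightarrow> g x s) (at x)"
      by (simp add: continuous_on_def)
    then have "\<forall>\<^sub>F x in at x. a < g x s" using s(2) by (rule order_tendstoD)
    then show "\<forall>\<^sub>F x in at x. a < (SUP s\<in>S. g x s)"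
      by eventually_elim (use s(1) in \<open>auto simp: less_SUP_iff\<close>)
  next
    fix a assume a: "(SUP s\<in>S. g x s) < a"
    obtain W where W: "open W" "W \<inter> (UNIV \<times> S) = (\<lambda>(x, s). g x s) -` {..<a} \<inter> (UNIV \<times> S)"
      using continuous_on_open_invariant[THEN iffD1, OF cont] by (meson open_lessThan)
    have "{x} \<times> S \<subseteq> W"
    proof
      fix z assume "z \<in> {x} \<times> S"
      moreover have "g x s < a" if "s \<in> S" for s
        using a that by (meson SUP_upper le_less_trans)
      ultimately have "z \<in> (\<lambda>(x, s). g x s) -` {..<a} \<inter> (UNIV \<times> S)" by auto
      then show "z \<in> W" using W by blast
    qed
    then obtain U where U: "open U" "x \<in> U" "U \<times> S \<subseteq> W"
      using Elementary_Topology.tube_lemma[OF S(1), of W x] W(1) by auto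
    \<comment> \<open>Pointwise strict bounds alone give only a weak bound on the supremum;
      strictness follows because the supremum is attained on the compact set.\<close>
    have "(SUP s\<in>S. g y s) < a" if "y \<in> U" for y
    proof -
      have "continuous_on S (\<lambda>s. case (y, s) of (x, s) \<Rightarrow> g x s)"
        by (rule continuous_on_compose2[OF cont]) (auto intro!: continuous_intros)
      then obtain s where s: "s \<in> S" "\<forall>t\<in>S. g y t \<le> g y s"
        using continuous_attains_sup[OF S, of "g y"] by auto
      have "(y, s) \<in> W \<inter> (UNIV \<times> S)" using U(3) that s(1) by auto
      then have "g y s < a" using W(2) by auto
      then show ?thesis using s(2) by (meson SUP_least le_less_trans)
    qed
    then show "\<forall>\<^sub>F x in at x. (SUP s\<in>S. g x s) < a"
      using U by (auto simp: eventually_at_topological)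
  qed
qed

lemma strictly_concave_on_imp_concave_on:
  assumes "strictly_concave_on S f"
  shows "concave_on S f"
  unfolding concave_on_iff
proof (intro conjI ballI allI impI)
  show "convex S" using assms by (simp add: strictly_concave_on_def)
  fix x y u v assume *: "x \<in> S" "y \<in> S" "0 \<le> u" "0 \<le> v" "u + v = (1::real)"
  then have v: "v = 1 - u" by simp
  show "u * f x + v * f y \<le> f (u *\<^sub>R x + v *\<^sub>R y)"
  proof (cases "x = y \<or> u = 0 \<or> u = 1")
    case True
    then show ?thesis using * by (auto simp: v simp flip: distrib_right)
  next
    case False
    then show ?thesis
      using assms * by (force simp: strictly_concave_on_def v intro: less_imp_le)
  qed
qed

lemma kernel_base_plus_int:
  assumes "kernel_base K"
  shows "K (t + 2 * pi * of_int m) = K t"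
proof -
  interpret periodic_fun_simple K "2 * pi"
    using assms by unfold_locales (simp add: kernel_base_def)
  show ?thesis using plus_of_int[of t m] by (simp add: mult.commute)
qed

lemma obtain_representative:
  obtains m :: int and c where "b = c + 2 * pi * of_int m" "0 \<le> c" "c < 2 * pi"
proof -
  let ?m = "\<lfloor>b / (2 * pi)\<rfloor>"
  have "2 * pi * of_int ?m \<le> b"
    using floor_divide_lower[of "2 * pi" b] by (simp add: mult.commute)
  moreover have "b < 2 * pi * of_int ?m + 2 * pi"
    using floor_divide_upper[of "2 * pi" b] by (simp add: algebra_simps)
  ultimately show ?thesis by (intro that[of "b - 2 * pi * of_int ?m" ?m]) auto
qed

text \<open>Continuity is meant in the extended reals, so a value \<open>-\<infinity>\<close> at 0
  is allowed. Inside the period it comes from concavity; at 0 periodicity turns the left limit at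
  \<open>2 * pi\<close> into a left limit at 0; translation covers all other points.\<close>

lemma concave_kernel_continuous:
  assumes "concave_kernel K"
  shows "continuous_on UNIV K"
proof -
  have base: "kernel_base K" and conc: "concave_on {0<..<2 * pi} (\<lambda>t. real_of_ereal (K t))"
    using assms by (auto simp: concave_kernel_def)
  obtain L where L: "(K \<longlongrightarrow> L) (at_right 0)" "(K \<longlongrightarrow> L) (at_left (2 * pi))" "K 0 = L"
    using base by (auto simp: kernel_base_def)
  have shift: "isCont K (c + d)" if "\<And>t. K (t + d) = K t" "isCont K c" for c d
  proof -
    have "((\<lambda>t. K (t + d)) \<longlongrightarrow> K (c + d)) (at c)"
      using that by (simp add: isCont_def)
    then show ?thesis
      using LIM_offset_zero_iff[of c] by (simp add: isCont_def filterlim_at_to_0[of K _ "c + d"]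
          filterlim_at_to_0[of _ _ c] add.assoc add.left_commute add.commute)
  qed
  have "isCont K c" if "0 \<le> c" "c < 2 * pi" for c
  proof (cases "c = 0")
    case True
    have "((\<lambda>t. K (t + 2 * pi)) \<longlongrightarrow> L) (at_left 0)"
      using L(2) by (simp add: filterlim_at_left_to_right filterlim_at_right_to_0[of _ _ "- (2 * pi)"])
    then have "(K \<longlongrightarrow> L) (at_left 0)"
      using base by (simp add: kernel_base_def)
    then show ?thesis
      using L True by (simp add: isCont_def filterlim_split_at)
  next
    case False
    then have c: "c \<in> {0<..<2 * pi}" using that by simp
    have "continuous_on {0<..<2 * pi} (\<lambda>t. - (- real_of_ereal (K t)))"
      using conc unfolding concave_on_def
      by (intro continuous_on_minus convex_on_continuous open_greaterThanLessThan)
    then have "continuous_on {0<..<2 * pi} (\<lambda>t. ereal (real_of_ereal (K t)))"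
      by (intro continuous_on_ereal) simp
    then have "continuous_on {0<..<2 * pi} K"
      by (rule continuous_on_eq) (use base in \<open>auto simp: kernel_base_def ereal_real\<close>)
    then show ?thesis using c by (simp add: continuous_on_eq_continuous_at)
  qed
  then have "isCont K b" for b
    using shift kernel_base_plus_int[OF base] by (metis obtain_representative[of b])
  then show ?thesis by (simp add: continuous_on_eq_continuous_at)
qed

lemma sum_ereal_neq_PInf:
  fixes f :: "'a \<Rightarrow> ereal"
  shows "(\<And>i. i \<in> A \<Longrightarrow> f i \<noteq> \<infinity>) \<Longrightarrow> sum f A \<noteq> \<infinity>"
  by (auto simp: sum_Pinfty)

text \<open>Excluding the value \<open>\<infinity>\<close> avoids the only discontinuity of extended
  addition, at \<open>\<infinity> + (-\<infinity>)\<close>.\<close>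

lemma continuous_on_sum_ereal:
  fixes f :: "'a \<Rightarrow> 'b::topological_space \<Rightarrow> ereal"
  assumes "finite I" "\<And>i. i \<in> I \<Longrightarrow> continuous_on S (f i)" "\<And>i x. i \<in> I \<Longrightarrow> f i x \<noteq> \<infinity>"
  shows "continuous_on S (\<lambda>x. \<Sum>i\<in>I. f i x)"
  using assms
proof (induction I rule: finite_induct)
  case (insert i I)
  then have "continuous_on S (f i)" "continuous_on S (\<lambda>x. \<Sum>i\<in>I. f i x)" by auto
  moreover have "f i x \<noteq> \<infinity>" "(\<Sum>i\<in>I. f i x) \<noteq> \<infinity>" for x
    using insert.prems by (auto intro!: sum_ereal_neq_PInf)
  ultimately show ?case
    using insert.hyps by (auto simp: continuous_on_def intro!: tendsto_add_ereal_general)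
qed simp

text \<open>Viewing \<open>K 0\<close> as translated by \<open>\<eta> 0 = 0\<close> puts all
  \<open>n + 1\<close> kernels on the same footing, while \<open>y 0\<close> may be
  arbitrary.\<close>

lemma sot_eq_sum:
  assumes "\<eta> 0 = 0" "\<And>j. j \<in> {1..n} \<Longrightarrow> \<eta> j = y j"
  shows "sot n K y t = (\<Sum>j\<le>n. K j (t - \<eta> j))"
proof -
  have "{..n} = insert 0 {1..n}" by auto
  then show ?thesis using assms by (simp add: sot_def)
qed

lemma continuous_on_sot:
  assumes kernels: "\<And>j. j \<le> n \<Longrightarrow> concave_kernel (K j)"
    and cont: "continuous_on S f" "\<And>j. j \<in> {1..n} \<Longrightarrow> continuous_on S (\<lambda>x. g x j)"
  shows "continuous_on S (\<lambda>x. sot n K (g x) (f x))"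
proof -
  define \<eta> where "\<eta> x j = (if j = 0 then 0 else g x j)" for x j
  have "continuous_on S (\<lambda>x. \<Sum>j\<le>n. K j (f x - \<eta> x j))"
  proof (rule continuous_on_sum_ereal)
    fix j assume "j \<in> {..n}"
    then have j: "j \<le> n" by simp
    have "continuous_on S (\<lambda>x. f x - \<eta> x j)"
      using cont j by (cases "j = 0") (auto simp: \<eta>_def intro!: continuous_intros)
    then show "continuous_on S (\<lambda>x. K j (f x - \<eta> x j))"
      by (rule continuous_on_compose2[OF concave_kernel_continuous[OF kernels[OF j]]]) simp
    show "K j (f x - \<eta> x j) \<noteq> \<infinity>" for x
      using kernels[OF j] by (simp add: concave_kernel_def kernel_base_def)
  qed simp
  moreover have "sot n K (g x) (f x) = (\<Sum>j\<le>n. K j (f x - \<eta> x j))" for x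
    by (rule sot_eq_sum) (auto simp: \<eta>_def)
  ultimately show ?thesis by simp
qed

lemma affine_image_unit_interval:
  fixes a b :: real
  assumes "a \<le> b"
  shows "(\<lambda>r. a + r * (b - a)) ` {0..1} = {a..b}"
proof -
  have "closed_segment a b = (\<lambda>r. a + r * (b - a)) ` {0..1}"
    unfolding closed_segment_image_interval by (rule image_cong) (auto simp: algebra_simps)
  then show ?thesis using assms by (simp add: closed_segment_eq_real_ivl)
qed

section \<open>Existence of equioscillation points\<close>

text \<open>Fractions are numbered from 0 and movable nodes from 1, hence \<open>j - 1\<close>. At
  \<open>k = n + 1\<close> the product is empty, which gives the right end
  \<open>2 * pi\<close>.\<close>

definition broken_stick :: "nat \<Rightarrow> (nat \<Rightarrow> real) \<Rightarrow> nat \<Rightarrow> real" where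
  "broken_stick n s k = (if k = 0 then 0 else 2 * pi * (\<Prod>j\<in>{k..n}. s (j - 1)))"

lemma broken_stick_Suc: "k < n \<Longrightarrow> broken_stick n s (Suc k) = s k * broken_stick n s (Suc (Suc k))"
  by (simp add: broken_stick_def prod.atLeast_Suc_atMost)

lemma broken_stick_mono:
  assumes "\<forall>j. s j \<in> {0..1}" "k \<le> n"
  shows "broken_stick n s k \<le> broken_stick n s (Suc k)"
proof (cases k)
  case 0
  then show ?thesis using assms by (auto simp: broken_stick_def intro!: mult_nonneg_nonneg prod_nonneg)
next
  case (Suc i)
  have "0 \<le> broken_stick n s (Suc k)"
    using assms by (auto simp: broken_stick_def intro!: mult_nonneg_nonneg prod_nonneg)
  moreover have "s i \<le> 1" using assms by simp
  ultimately show ?thesis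
    using Suc assms by (simp add: broken_stick_Suc mult_left_le_one_le)
qed

theorem equioscillation_point_exists:
  assumes kernels: "\<And>j. j \<le> n \<Longrightarrow> concave_kernel (K j)"
    and perm: "\<sigma> permutes {1..n}"
  shows "\<exists>y. equioscillation_point n K \<sigma> y"
proof -
  define Z where "Z = broken_stick n"
  \<comment> \<open>\<open>Z s\<close> lists the nodes from left to right, whereas \<open>y\<close>
    is indexed by kernels; the inverse permutation translates between the two.\<close>
  define Y where "Y s j = Z s (inv \<sigma> j)" for s j
  \<comment> \<open>Each interval is parametrised by the unit interval, so the supremum runs over a
    fixed compact set. This makes \<open>M k\<close> continuous for every \<open>s\<close>; it
    equals the interval maximum for \<open>s\<close> in the cube.\<close>
  define M where "M k s = (SUP r\<in>{0..1}. sot n K (Y s) (Z s k + r * (Z s (Suc k) - Z s k)))" for k s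
  have Z_cont: "continuous_on UNIV (\<lambda>s. Z s k)" for k
    unfolding Z_def broken_stick_def
    by (cases "k = 0") (auto intro!: continuous_intros)
  have M_cont: "continuous_on UNIV (M k)" for k
  proof -
    have Z_cont': "continuous_on (UNIV \<times> {0..1::real}) (\<lambda>x. Z (fst x) k)" for k
      by (rule continuous_on_compose2[OF Z_cont continuous_on_fst[OF continuous_on_id]]) simp
    have "continuous_on (UNIV \<times> {0..1})
        (\<lambda>x. sot n K (Y (fst x)) (Z (fst x) k + snd x * (Z (fst x) (Suc k) - Z (fst x) k)))"
      by (rule continuous_on_sot[OF kernels])
         (auto simp: Y_def intro!: continuous_intros Z_cont')
    then show ?thesis
      unfolding M_def by (intro continuous_on_SUP_compact) (auto simp: case_prod_beta)
  qed
  have node: "ynode n (Y s) (\<sigma> k) = Z s k" if k: "k \<le> Suc n" for s k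
  proof -
    consider "k = 0" | "k = Suc n" | "k \<in> {1..n}" using k by (cases "k = 0 \<or> k = Suc n") auto
    then show ?thesis
    proof cases
      case 3
      then have "\<sigma> k \<in> {1..n}" using perm by (simp only: permutes_in_image)
      then show ?thesis using permutes_inverses[OF perm] by (simp add: ynode_def Y_def)
    qed (use permutes_not_in[OF perm] in \<open>auto simp: ynode_def Z_def broken_stick_def\<close>)
  qed
  have M_eq: "interval_max n K \<sigma> (Y s) k = M k s" if "\<forall>j. s j \<in> {0..1}" "k \<le> n" for s k
  proof -
    have "{Z s k..Z s (Suc k)} = (\<lambda>r. Z s k + r * (Z s (Suc k) - Z s k)) ` {0..1}"
      by (rule affine_image_unit_interval[symmetric]) (use broken_stick_mono that in \<open>auto simp: Z_def\<close>)
    then show ?thesis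
      using that by (simp add: interval_max_def node M_def image_image)
  qed
  have M_upper: "sot n K (Y s) (Z s k) \<le> M k s" "sot n K (Y s) (Z s (Suc k)) \<le> M k s" for s k
    unfolding M_def by (auto intro: SUP_upper2[of 0] SUP_upper2[of 1])
  have M_degenerate: "M k s = sot n K (Y s) (Z s k)" if "Z s k = Z s (Suc k)" for s k
    using that by (simp add: M_def)
  \<comment> \<open>The fraction \<open>s i\<close> moves node \<open>i + 1\<close>, which separates
    intervals \<open>i\<close> and \<open>i + 1\<close>, so it is paired with the equation between
    their two maxima.\<close>
  have "\<exists>s. (\<forall>j. s j \<in> {0..1}) \<and> (\<forall>i<n. M i s = M (Suc i) s)"
  proof (rule poincare_miranda[where v = "\<lambda>i. M (Suc i)"])
    fix i and s :: "nat \<Rightarrow> real" assume i: "i < n" and s: "\<forall>j. s j \<in> {0..1}"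
    {
      assume "s i = 0"
      \<comment> \<open>Node \<open>i + 1\<close> drags the node before it to 0, so interval
        \<open>i\<close> shrinks to the left end of interval \<open>i + 1\<close>. On the opposite
        face interval \<open>i + 1\<close> shrinks to the right end of interval
        \<open>i\<close>.\<close>
      then have "Z s (Suc i) = 0" using i by (simp add: Z_def broken_stick_Suc)
      moreover have "0 \<le> Z s i"
        using s by (auto simp: Z_def broken_stick_def intro!: mult_nonneg_nonneg prod_nonneg)
      ultimately have "Z s i = Z s (Suc i)"
        using broken_stick_mono[OF s, of i n] i by (auto simp: Z_def)
      then show "M i s \<le> M (Suc i) s" using M_degenerate M_upper by metis
    next
      assume "s i = 1"
      then have "Z s (Suc i) = Z s (Suc (Suc i))" using i by (simp add: Z_def broken_stick_Suc)
      then show "M (Suc i) s \<le> M i s" using M_degenerate M_upper by metis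
    }
  qed (use M_cont in auto)
  then obtain s where s: "\<forall>j. s j \<in> {0..1}" and step: "\<forall>i<n. M i s = M (Suc i) s" by blast
  have M_const: "M k s = M 0 s" if "k \<le> n" for k
    using that step by (induction k) auto
  have "equioscillation_point n K \<sigma> (Y s)"
    unfolding equioscillation_point_def
  proof (intro conjI allI impI)
    show "Y s \<in> closed_simplex n \<sigma>"
      using broken_stick_mono[OF s] by (simp add: closed_simplex_def node) (simp add: Z_def)
    show "interval_max n K \<sigma> (Y s) k = interval_max n K \<sigma> (Y s) 0" if "k \<le> n" for k
      using M_const[OF that] that by (simp add: M_eq[OF s])
  qed
  then show ?thesis by blast
qed

section \<open>One-sided difference quotients of concave functions and kernels\<close>

text \<open>Contract towards the midpoint: contraction is affine, so it commutes with convex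
  combinations, and it moves all points into the open interval. Then let the contraction parameter
  \<open>e\<close> tend to 0.\<close>

lemma concave_on_closed_interval:
  fixes f :: "real \<Rightarrow> real"
  assumes conc: "concave_on {a<..<b} f" and cont: "continuous_on {a..b} f" and "a < b"
  shows "concave_on {a..b} f"
  unfolding concave_on_iff
proof (intro conjI ballI allI impI)
  fix x y u v assume x: "x \<in> {a..b}" and y: "y \<in> {a..b}" and uv: "0 \<le> u" "0 \<le> v" "u + v = (1::real)"
  define c where "c = (a + b) / 2"
  define p where "p z e = z + e * (c - z)" for z e :: real
  have p_in: "p z e \<in> {a<..<b}" if "z \<in> {a..b}" "0 < e" "e < 1" for z e
  proof -
    have c: "a < c" "c < b" using \<open>a < b\<close> by (auto simp: c_def)
    have "(1 - e) * a \<le> (1 - e) * z" "(1 - e) * z \<le> (1 - e) * b" "e * a < e * c" "e * c < e * b"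
      using that c by (auto intro!: mult_left_mono mult_strict_left_mono)
    then show ?thesis by (auto simp: p_def algebra_simps)
  qed
  have p_lim: "(p z \<longlongrightarrow> z) (at_right 0)" for z
    unfolding p_def by (auto intro!: tendsto_eq_intros)
  have ev: "\<forall>\<^sub>F e in at_right 0. 0 < e \<and> e < (1::real)"
    by (auto simp: eventually_at_right_field intro!: exI[of _ 1])
  have f_lim: "((\<lambda>e. f (p z e)) \<longlongrightarrow> f z) (at_right 0)" if z: "z \<in> {a..b}" for z
    by (rule continuous_on_tendsto_compose[OF cont p_lim z])
       (use ev in \<open>eventually_elim, use p_in[OF z] in fastforce\<close>)
  have mix: "u * x + v * y \<in> {a..b}"
    using convex_real_interval(5)[of a b] x y uv by (auto simp: convex_def)
  have p_mix: "p (u * x + v * y) e = u * p x e + v * p y e" for e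
    using uv(3) by (simp add: p_def algebra_simps) (metis distrib_left mult.right_neutral)
  have "\<forall>\<^sub>F e in at_right 0. u * f (p x e) + v * f (p y e) \<le> f (p (u * x + v * y) e)"
    using ev
  proof eventually_elim
    case (elim e)
    then show ?case
      using conc p_in[OF x, of e] p_in[OF y, of e] uv by (auto simp: concave_on_iff p_mix)
  qed
  then have "u * f x + v * f y \<le> f (u * x + v * y)"
    by (intro tendsto_le[OF _ f_lim[OF mix] tendsto_add[OF tendsto_mult_left[OF f_lim[OF x]]
          tendsto_mult_left[OF f_lim[OF y]]]]) auto
  then show "u * f x + v * f y \<le> f (u *\<^sub>R x + v *\<^sub>R y)" by simp
qed auto

lemma concave_on_slope_le:
  fixes f :: "real \<Rightarrow> real"
  assumes "concave_on I f" "x \<in> I" "y \<in> I" "x < t" "t < y"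
  shows "(f y - f x) / (y - x) \<le> (f t - f x) / (t - x)"
    and "(f y - f t) / (y - t) \<le> (f y - f x) / (y - x)"
  using convex_on_slope_le[OF assms(1)[unfolded concave_on_def] assms(2-5)] assms(4,5)
  by (auto simp: divide_simps mult.commute algebra_simps)

text \<open>The quotients grow as \<open>h\<close> decreases and are bounded by the slope of a chord
  to the left, so they converge. Existence of the limit matters because \<open>right_deriv\<close>
  and \<open>left_deriv\<close> are defined by \<open>Lim\<close>, which is meaningful only for
  convergent quotients.\<close>

lemma concave_on_right_quotient_tendsto:
  fixes f :: "real \<Rightarrow> real"
  assumes conc: "concave_on {a..b} f" and x: "a \<le> x" "x < t" and t: "t < b"
  shows "\<exists>l \<le> (f t - f x) / (t - x). ((\<lambda>h. (f (t + h) - f t) / h) \<longlongrightarrow> l) (at_right 0)"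
proof -
  define q where "q h = (f (t + h) - f t) / h" for h
  let ?I = "{..<b - t}"
  have q_le: "q h \<le> (f t - f x) / (t - x)" if "0 < h" "h < b - t" for h
    using concave_on_slope_le[OF conc, of x "t + h" t] that x t by (auto simp: q_def)
  have q_mono: "q h' \<le> q h" if "0 < h" "h \<le> h'" "h' < b - t" for h h'
    using concave_on_slope_le(1)[OF conc, of t "t + h'" "t + h"] that x t
    by (cases "h = h'") (auto simp: q_def)
  \<comment> \<open>Negation turns the decreasing quotient into an increasing function of
    \<open>h\<close> that is bounded below, whose right limit is its infimum.\<close>
  have "((\<lambda>h. - q h) \<longlongrightarrow> Inf ((\<lambda>h. - q h) ` ({0<..} \<inter> ?I))) (at 0 within ({0<..} \<inter> ?I))"
    by (rule Lim_right_bound[where K = "- ((f t - f x) / (t - x))"]) (use q_le q_mono in auto)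
  moreover have "at 0 within ({0<..} \<inter> ?I) = at_right 0"
    by (rule at_within_nhd[of _ "?I"]) (use t in auto)
  ultimately obtain m where "((\<lambda>h. - q h) \<longlongrightarrow> m) (at_right 0)" by metis
  then have lim: "(q \<longlongrightarrow> - m) (at_right 0)" using tendsto_minus by force
  have "\<forall>\<^sub>F h in at_right 0. q h \<le> (f t - f x) / (t - x)"
    using q_le t by (auto simp: eventually_at_right_field intro!: exI[of _ "b - t"])
  then have "- m \<le> (f t - f x) / (t - x)"
    by (rule tendsto_upperbound[OF lim]) simp
  with lim show ?thesis by (auto simp: q_def[abs_def])
qed

lemma right_deriv_le_slope:
  assumes "concave_on {a..b} f" "a \<le> x" "x < t" "t < b"
  shows "right_deriv f t \<le> (f t - f x) / (t - x)"
  using concave_on_right_quotient_tendsto[OF assms] tendsto_Lim[OF trivial_limit_at_right_real]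
  by (auto simp: right_deriv_def)

lemma concave_on_reflect:
  fixes f :: "real \<Rightarrow> real"
  assumes "concave_on {a..b} f"
  shows "concave_on {- b..- a} (\<lambda>t. f (- t))"
  unfolding concave_on_iff
proof (intro conjI ballI allI impI)
  fix x y u v assume "x \<in> {- b..- a}" "y \<in> {- b..- a}" "0 \<le> u" "0 \<le> v" "u + v = (1::real)"
  then have "u * f (- x) + v * f (- y) \<le> f (u *\<^sub>R (- x) + v *\<^sub>R (- y))"
    using assms unfolding concave_on_iff by (metis atLeastAtMost_iff minus_le_iff le_minus_iff)
  then show "u * f (- x) + v * f (- y) \<le> f (- (u *\<^sub>R x + v *\<^sub>R y))" by (simp add: algebra_simps)
qed auto

lemma slope_le_left_deriv:
  assumes "concave_on {a..b} f" "a < t" "t < x" "x \<le> b"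
  shows "(f x - f t) / (x - t) \<le> left_deriv f t"
proof -
  obtain l where l: "l \<le> (f t - f x) / (x - t)" "((\<lambda>h. (f (t - h) - f t) / h) \<longlongrightarrow> l) (at_right 0)"
    using concave_on_right_quotient_tendsto[OF concave_on_reflect[OF assms(1)], of "- x" "- t"] assms(2-4)
    by auto
  have "((\<lambda>h. - ((f (t - h) - f t) / h)) \<longlongrightarrow> - l) (at_right 0)"
    using l(2) by (rule tendsto_minus)
  then have "((\<lambda>h. (f (t + h) - f t) / h) \<longlongrightarrow> - l) (at_left 0)"
    by (simp add: filterlim_at_left_to_right)
  then have "left_deriv f t = - l"
    unfolding left_deriv_def by (intro tendsto_Lim) auto
  moreover have "(f x - f t) / (x - t) = - ((f t - f x) / (x - t))" by (simp add: diff_divide_distrib)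
  ultimately show ?thesis using l(1) by linarith
qed

section \<open>One-sided slopes of kernels\<close>

lemma strictly_concave_kernel_imp_concave_kernel:
  "strictly_concave_kernel K \<Longrightarrow> concave_kernel K"
  by (simp add: strictly_concave_kernel_def concave_kernel_def strictly_concave_on_imp_concave_on)

lemma kernel_2pi: "kernel_base K \<Longrightarrow> K (2 * pi) = K 0"
  using kernel_base_plus_int[of K 0 1] by simp

text \<open>Turns estimates to the right of a point into estimates to the left. By periodicity
  \<open>K (- t) = K (2 * pi - t)\<close>, so the reflection can be carried out inside one
  period.\<close>

lemma strictly_concave_kernel_reflect:
  assumes "strictly_concave_kernel K"
  shows "strictly_concave_kernel (\<lambda>t. K (- t))"
proof -
  have base: "kernel_base K"
    and strict: "strictly_concave_on {0<..<2 * pi} (\<lambda>t. real_of_ereal (K t))"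
    using assms by (auto simp: strictly_concave_kernel_def)
  have per: "K (- t) = K (2 * pi - t)" for t
    using kernel_base_plus_int[OF base, of "- t" 1] by (simp add: algebra_simps)
  obtain L where L: "L \<noteq> \<infinity>" "(K \<longlongrightarrow> L) (at_right 0)" "(K \<longlongrightarrow> L) (at_left (2 * pi))" "K 0 = L"
    using base by (auto simp: kernel_base_def)
  have lims: "((\<lambda>t. K (2 * pi - t)) \<longlongrightarrow> L) (at_right 0)" "((\<lambda>t. K (2 * pi - t)) \<longlongrightarrow> L) (at_left (2 * pi))"
    using L(2,3) by (simp_all add: filterlim_at_left_to_right filterlim_at_right_to_0[of _ _ "- (2 * pi)"])
  have "K (- t) \<noteq> - \<infinity>" if "t \<in> {0<..<2 * pi}" for t
    using base that unfolding per by (auto simp: kernel_base_def)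
  moreover have "K (- (t + 2 * pi)) = K (- t)" for t
    using kernel_base_plus_int[OF base, of "- t" "-1"] by (simp add: algebra_simps)
  ultimately have "kernel_base (\<lambda>t. K (- t))"
    using base L lims kernel_2pi[OF base] by (auto simp: kernel_base_def per)
  moreover have "strictly_concave_on {0<..<2 * pi} (\<lambda>t. real_of_ereal (K (- t)))"
    unfolding strictly_concave_on_def per
  proof (intro conjI ballI allI impI)
    fix x y u assume *: "x \<in> {0<..<2 * pi}" "y \<in> {0<..<2 * pi}" "x \<noteq> y" "0 < u \<and> u < (1::real)"
    have eq: "2 * pi - (u * x + (1 - u) * y) = u * (2 * pi - x) + (1 - u) * (2 * pi - y)"
      by (simp add: algebra_simps)
    show "u * real_of_ereal (K (2 * pi - x)) + (1 - u) * real_of_ereal (K (2 * pi - y))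
        < real_of_ereal (K (2 * pi - (u * x + (1 - u) * y)))"
      unfolding eq using strict * by (auto simp: strictly_concave_on_def)
  qed auto
  ultimately show ?thesis by (simp add: strictly_concave_kernel_def)
qed

text \<open>Finiteness at 0 makes the real-valued version continuous up to both ends;
  \<open>real_of_ereal\<close> would otherwise replace \<open>-\<infinity>\<close> by 0
  there.\<close>

lemma kernel_concave_on_closed:
  assumes "concave_kernel K" and fin: "K 0 \<noteq> - \<infinity>"
  shows "concave_on {0..2 * pi} (\<lambda>t. real_of_ereal (K t))"
proof (rule concave_on_closed_interval)
  have base: "kernel_base K" using assms by (simp add: concave_kernel_def)
  have "K t \<notin> {\<infinity>, - \<infinity>}" if "t \<in> {0..2 * pi}" for t
    using that base fin kernel_2pi[OF base]
    by (cases "t = 0 \<or> t = 2 * pi") (auto simp: kernel_base_def)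
  moreover have "continuous_on {0..2 * pi} K"
    using concave_kernel_continuous[OF assms(1)] continuous_on_subset by blast
  ultimately show "continuous_on {0..2 * pi} (\<lambda>t. real_of_ereal (K t))"
    by (intro continuous_on_compose2[OF continuous_on_real]) auto
qed (use assms in \<open>auto simp: concave_kernel_def\<close>)

text \<open>The values at 0 and \<open>2 * pi\<close> agree, so concavity keeps the kernel at or
  above this value in between. Strict concavity is available only in the open interval, so it is
  applied to \<open>pi / 2\<close> and \<open>3 * pi / 2\<close>, whose midpoint is
  \<open>pi\<close>.\<close>

lemma kernel_pi_gt:
  assumes K: "strictly_concave_kernel K" and fin: "K 0 \<noteq> - \<infinity>"
  shows "real_of_ereal (K 0) < real_of_ereal (K pi)"
proof -
  let ?k = "\<lambda>t. real_of_ereal (K t)"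
  have conc: "concave_on {0..2 * pi} ?k"
    using K fin kernel_concave_on_closed strictly_concave_kernel_imp_concave_kernel by blast
  have "?k 0 \<le> ?k (u * (2 * pi))" if "0 \<le> u" "u \<le> 1" for u
    using concave_onD[OF conc, of u 0 "2 * pi"] that kernel_2pi[of K] K
    by (simp add: strictly_concave_kernel_def left_diff_distrib)
  from this[of "1/4"] this[of "3/4"] have "?k 0 \<le> ?k (pi / 2)" "?k 0 \<le> ?k (3 * pi / 2)" by simp_all
  moreover have "1/2 * ?k (pi / 2) + (1 - 1/2) * ?k (3 * pi / 2) < ?k (1/2 * (pi / 2) + (1 - 1/2) * (3 * pi / 2))"
    using K unfolding strictly_concave_kernel_def strictly_concave_on_def
    by (elim conjE) (drule bspec[of _ _ "pi / 2"], simp, drule bspec[of _ _ "3 * pi / 2"], simp,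
      elim impE, simp, drule spec[of _ "1/2"], simp)
  ultimately show ?thesis by (simp add: field_simps)
qed

text \<open>This is the cusp: chord slopes from 0 decrease with length, and the slope of the chord
  to \<open>pi\<close> is positive by \<open>kernel_pi_gt\<close>.\<close>

lemma kernel_quotient_at_0_ge:
  assumes K: "strictly_concave_kernel K" and fin: "K 0 \<noteq> - \<infinity>" and h: "0 < h" "h < pi"
  shows "(real_of_ereal (K pi) - real_of_ereal (K 0)) / pi \<le> (real_of_ereal (K h) - real_of_ereal (K 0)) / h"
  using concave_on_slope_le(1)[OF kernel_concave_on_closed[OF strictly_concave_kernel_imp_concave_kernel[OF K] fin],
      of 0 pi h] h by simp

lemma eventually_at_right_0_less: "0 < d \<Longrightarrow> \<forall>\<^sub>F h in at_right 0. 0 < h \<and> h < (d::real)"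
  by (auto simp: eventually_at_right_field)

text \<open>Slopes of short chords to the right of \<open>b\<close> are at least that of one fixed
  longer chord inside the same period. At a centre this uses concavity up to the endpoint; elsewhere
  the open period suffices, so the kernel may be \<open>-\<infinity>\<close> at its centre.\<close>

lemma kernel_quotient_bounded_below:
  assumes K: "strictly_concave_kernel K" and fin: "K b \<noteq> - \<infinity>"
  shows "\<exists>C. \<forall>\<^sub>F h in at_right 0. C \<le> (real_of_ereal (K (b + h)) - real_of_ereal (K b)) / h"
proof -
  let ?k = "\<lambda>t. real_of_ereal (K t)"
  have base: "kernel_base K" using K by (simp add: strictly_concave_kernel_def)
  obtain m c where b: "b = c + 2 * pi * of_int m" and c: "0 \<le> c" "c < 2 * pi"
    by (rule obtain_representative)
  have shift: "K (b + h) = K (c + h)" for h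
    using kernel_base_plus_int[OF base, of "c + h" m] by (simp add: b algebra_simps)
  \<comment> \<open>Half the distance to the end of the period keeps the reference chord strictly
    inside it.\<close>
  define d where "d = (2 * pi - c) / 2"
  have d: "0 < d" "c + d < 2 * pi" using c by (auto simp: d_def field_simps)
  have "(?k (c + d) - ?k c) / d \<le> (?k (c + h) - ?k c) / h" if h: "0 < h" "h < d" for h
  proof (cases "c = 0")
    case True
    then have "K 0 \<noteq> - \<infinity>" using shift[of 0] fin by simp
    then show ?thesis
      using concave_on_slope_le(1)[OF kernel_concave_on_closed[OF strictly_concave_kernel_imp_concave_kernel[OF K]],
          of c "c + d" "c + h"] c d h by simp
  next
    case False
    then show ?thesis
      using concave_on_slope_le(1)[OF strictly_concave_on_imp_concave_on, of "{0<..<2 * pi}" ?k c "c + d" "c + h"]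
        K c d h by (simp add: strictly_concave_kernel_def)
  qed
  then have "\<forall>\<^sub>F h in at_right 0. (?k (c + d) - ?k c) / d \<le> (?k (c + h) - ?k c) / h"
    using eventually_at_right_0_less[OF d(1)] by (auto elim: eventually_mono)
  then show ?thesis using shift shift[of 0] by auto
qed

text \<open>Away from the centres the two one-sided quotients cancel in the limit, giving 0; at a
  centre the two cusp slopes add up to a positive constant. A minorant \<open>w\<close> is used
  because the quotient itself may diverge at a centre.\<close>

lemma kernel_second_quotient:
  assumes K: "strictly_concave_kernel K" and C1: "kernel_C1 K" and fin: "K b \<noteq> - \<infinity>"
  shows "\<exists>w c. (w \<longlongrightarrow> c) (at_right 0) \<and> 0 \<le> c \<and> (b \<in> range (\<lambda>m. 2 * pi * of_int m) \<longrightarrow> 0 < c) \<and>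
    (\<forall>\<^sub>F h in at_right 0. w h \<le> (real_of_ereal (K (b + h)) - real_of_ereal (K b)) / h
        + (real_of_ereal (K (b - h)) - real_of_ereal (K b)) / h)"
proof -
  let ?k = "\<lambda>t. real_of_ereal (K t)"
  have base: "kernel_base K" using K by (simp add: strictly_concave_kernel_def)
  obtain m c where b: "b = c + 2 * pi * of_int m" and c: "0 \<le> c" "c < 2 * pi"
    by (rule obtain_representative)
  have shift: "K (b + h) = K (c + h)" for h
    using kernel_base_plus_int[OF base, of "c + h" m] by (simp add: b algebra_simps)
  have shift': "K b = K c" "K (b - h) = K (c - h)" for h
    using shift[of 0] shift[of "- h"] by auto
  show ?thesis
  proof (cases "c = 0")
    case True
    with fin have fin0: "K 0 \<noteq> - \<infinity>" by (simp add: shift')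
    define R where "R = (\<lambda>t. K (- t))"
    have R: "strictly_concave_kernel R" "R 0 \<noteq> - \<infinity>"
      using strictly_concave_kernel_reflect[OF K] fin0 by (auto simp: R_def)
    let ?s = "(?k pi - ?k 0) / pi + (real_of_ereal (R pi) - real_of_ereal (R 0)) / pi"
    have "0 < ?s"
      using kernel_pi_gt[OF K fin0] kernel_pi_gt[OF R] by (auto intro!: add_pos_pos)
    moreover have "\<forall>\<^sub>F h in at_right 0. ?s \<le> (?k (0 + h) - ?k 0) / h + (?k (0 - h) - ?k 0) / h"
      using eventually_at_right_0_less[OF pi_gt_zero]
    proof eventually_elim
      case (elim h)
      then show ?case
        using add_mono[OF kernel_quotient_at_0_ge[OF K fin0] kernel_quotient_at_0_ge[OF R], of h h]
        by (simp add: R_def)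
    qed
    ultimately show ?thesis
      by (intro exI[of _ "\<lambda>_. ?s"] exI[of _ ?s]) (auto simp: shift shift' True)
  next
    case False
    then have "c \<in> {0<..<2 * pi}" using c by simp
    then have "?k differentiable (at c)"
      using C1 by (auto simp: kernel_C1_def C1_differentiable_on_eq)
    then obtain D where D: "(?k has_real_derivative D) (at c)"
      by (auto simp: real_differentiable_def)
    have 1: "((\<lambda>h. (?k (c + h) - ?k c) / h) \<longlongrightarrow> D) (at_right 0)"
      using D by (simp add: DERIV_def filterlim_at_split)
    have "((\<lambda>h. (?k (c + h) - ?k c) / h) \<longlongrightarrow> D) (at_left 0)"
      using D by (simp add: DERIV_def filterlim_at_split)
    then have "((\<lambda>h. - ((?k (c + - h) - ?k c) / - h)) \<longlongrightarrow> - D) (at_right 0)"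
      unfolding filterlim_at_left_to_right by (intro tendsto_minus) simp
    then have "((\<lambda>h. (?k (c - h) - ?k c) / h) \<longlongrightarrow> - D) (at_right 0)" by simp
    from tendsto_add[OF 1 this]
    have "((\<lambda>h. (?k (b + h) - ?k b) / h + (?k (b - h) - ?k b) / h) \<longlongrightarrow> 0) (at_right 0)"
      by (simp add: shift shift')
    \<comment> \<open>The positivity clause is vacuous here: the representative \<open>c\<close>
      lies strictly inside the period.\<close>
    moreover have "b \<noteq> 2 * pi * of_int i" for i
    proof
      assume "b = 2 * pi * of_int i"
      then have eq: "c = 2 * pi * of_int (i - m)" by (simp add: b algebra_simps)
      have "0 < c" using c False by simp
      then have "0 < of_int (i - m) * (2 * pi)" "of_int (i - m) * (2 * pi) < 1 * (2 * pi)"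
        using c eq by (simp_all add: mult.commute)
      then have "0 < real_of_int (i - m)" "real_of_int (i - m) < 1"
        using zero_less_mult_pos2[of "of_int (i - m)" "2 * pi"] mult_less_cancel_right_pos[of "2 * pi" "of_int (i - m)" 1]
        by simp_all
      then have "0 < i - m" "i - m < 1" by (simp_all only: of_int_0_less_iff of_int_less_1_iff)
      then show False by simp
    qed
    ultimately show ?thesis by (intro exI conjI) auto
  qed
qed

text \<open>By concavity, the derivative at the inner end of a chord starting at 0 is at most its
  slope, so blow-up of the derivative forces blow-up of the quotient. For blow-up at
  \<open>2 * pi\<close>, periodicity moves the chord to the left of 0.\<close>

lemma cond_infty'_quotient_at_top:
  assumes K: "concave_kernel K" and fin: "K 0 \<noteq> - \<infinity>" and cond: "cond_infty' K"
  shows "filterlim (\<lambda>h. (real_of_ereal (K h) - real_of_ereal (K 0)) / h) at_top (at_right 0) \<or>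
    filterlim (\<lambda>h. (real_of_ereal (K (- h)) - real_of_ereal (K 0)) / h) at_top (at_right 0)"
proof -
  define k where "k t = real_of_ereal (K t)" for t
  have base: "kernel_base K" using K by (simp add: concave_kernel_def)
  have conc: "concave_on {0..2 * pi} k"
    using kernel_concave_on_closed[OF K fin] by (simp add: k_def[abs_def])
  have ev: "\<forall>\<^sub>F h in at_right 0. 0 < h \<and> h < 2 * pi"
    by (rule eventually_at_right_0_less) simp
  from cond consider "filterlim (left_deriv k) at_bot (at_left (2 * pi))"
    | "filterlim (right_deriv k) at_top (at_right 0)"
    by (auto simp: cond_infty'_def Let_def k_def[abs_def])
  then show ?thesis
  proof cases
    case 1
    then have lim: "filterlim (\<lambda>h. - left_deriv k (2 * pi - h)) at_top (at_right 0)"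
      by (simp add: filterlim_at_left_to_right filterlim_at_right_to_0[of _ _ "- (2 * pi)"] filterlim_uminus_at_top)
    have "filterlim (\<lambda>h. (k (- h) - k 0) / h) at_top (at_right 0)"
      using lim
    proof (rule filterlim_at_top_mono)
      show "\<forall>\<^sub>F h in at_right 0. - left_deriv k (2 * pi - h) \<le> (k (- h) - k 0) / h"
        using ev
      proof eventually_elim
        case (elim h)
        have "k (2 * pi - h) = k (- h)" "k (2 * pi) = k 0"
          using kernel_base_plus_int[OF base, of "- h" 1] kernel_2pi[OF base] by (auto simp: k_def)
        moreover have "(k (2 * pi) - k (2 * pi - h)) / h \<le> left_deriv k (2 * pi - h)"
          using slope_le_left_deriv[OF conc, of "2 * pi - h" "2 * pi"] elim by simp
        ultimately show ?case by (simp add: diff_divide_distrib)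
      qed
    qed
    then show ?thesis by (simp add: k_def)
  next
    case 2
    then have "filterlim (\<lambda>h. (k h - k 0) / h) at_top (at_right 0)"
    proof (rule filterlim_at_top_mono)
      show "\<forall>\<^sub>F h in at_right 0. right_deriv k h \<le> (k h - k 0) / h"
        using ev by eventually_elim (use right_deriv_le_slope[OF conc, of 0] in auto)
    qed
    then show ?thesis by (simp add: k_def)
  qed
qed

section \<open>Auxiliary facts on sums and nodes\<close>

lemma sum_ereal_eq_MInf:
  fixes f :: "'a \<Rightarrow> ereal"
  assumes "finite A" "\<And>i. i \<in> A \<Longrightarrow> f i \<noteq> \<infinity>"
  shows "sum f A = - \<infinity> \<longleftrightarrow> (\<exists>i\<in>A. f i = - \<infinity>)"
  using assms
proof (induction A rule: finite_induct)
  case (insert i A)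
  moreover have "sum f A \<noteq> \<infinity>" using insert.prems by (auto simp: sum_Pinfty)
  ultimately show ?case by (cases "f i"; cases "sum f A") auto
qed simp

lemma sum_at_top_not_nonpos:
  fixes P :: "'a \<Rightarrow> real \<Rightarrow> real"
  assumes I: "finite I" "i \<in> I" and top: "filterlim (P i) at_top F" and F: "F \<noteq> bot"
    and below: "\<And>j. j \<in> I \<Longrightarrow> \<exists>C. \<forall>\<^sub>F h in F. C \<le> P j h"
    and nonpos: "\<forall>\<^sub>F h in F. (\<Sum>j\<in>I. P j h) \<le> 0"
  shows False
proof -
  obtain C where C: "\<And>j. j \<in> I \<Longrightarrow> \<forall>\<^sub>F h in F. C j \<le> P j h" using below by metis
  have "\<forall>\<^sub>F h in F. \<forall>j\<in>I. C j \<le> P j h" using I(1) C by (simp add: eventually_ball_finite_distrib)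
  moreover have "\<forall>\<^sub>F h in F. - (\<Sum>j\<in>I - {i}. C j) + 1 \<le> P i h"
    using top by (simp add: filterlim_at_top)
  ultimately have "\<forall>\<^sub>F h in F. False"
    using nonpos
  proof eventually_elim
    case (elim h)
    have "(\<Sum>j\<in>I - {i}. C j) \<le> (\<Sum>j\<in>I - {i}. P j h)" using elim by (intro sum_mono) auto
    moreover have "(\<Sum>j\<in>I. P j h) = P i h + (\<Sum>j\<in>I - {i}. P j h)" using I by (rule sum.remove)
    ultimately show False using elim by linarith
  qed
  then show False using F by simp
qed

text \<open>A discrete intermediate value argument; it places every point of the period in one of
  the intervals.\<close>

lemma monotone_nodes_cover:
  fixes z :: "nat \<Rightarrow> real"
  assumes "z 0 \<le> c" "c \<le> z (Suc n)"
  shows "\<exists>k\<le>n. z k \<le> c \<and> c \<le> z (Suc k)"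
  using assms(2)
proof (induction n)
  case (Suc n)
  then show ?case by (cases "c \<le> z (Suc n)") (auto intro: le_SucI)
qed (use assms(1) in auto)

section \<open>Equioscillation points lie in the open simplex\<close>

context
  fixes n :: nat and K :: "nat \<Rightarrow> real \<Rightarrow> ereal" and \<eta> :: "nat \<Rightarrow> real" and a :: real
  assumes kernels: "\<And>j. j \<le> n \<Longrightarrow> strictly_concave_kernel (K j)"
    and finite_at: "\<And>j. j \<le> n \<Longrightarrow> K j (a - \<eta> j) \<noteq> - \<infinity>"
    and maximal: "\<And>t. (\<Sum>j\<le>n. K j (t - \<eta> j)) \<le> (\<Sum>j\<le>n. K j (a - \<eta> j))"
begin

private abbreviation "kr j t \<equiv> real_of_ereal (K j t)"

private lemma kernels_PInf: "j \<le> n \<Longrightarrow> K j t \<noteq> \<infinity>"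
  using kernels by (auto simp: strictly_concave_kernel_def kernel_base_def)

text \<open>The sign \<open>e\<close> selects the direction. By continuity all kernels stay finite
  near \<open>a\<close>, so the maximality inequality passes from extended reals to reals and can be
  rearranged into quotients.\<close>

private lemma sum_quotient_nonpos:
  assumes e: "e = 1 \<or> e = - (1::real)"
  shows "\<forall>\<^sub>F h in at_right 0. (\<Sum>j\<le>n. (kr j (a - \<eta> j + e * h) - kr j (a - \<eta> j)) / h) \<le> 0"
proof -
  have "\<forall>\<^sub>F h in at_right 0. - \<infinity> < K j (a - \<eta> j + e * h)" if j: "j \<le> n" for j
  proof -
    have "isCont (K j) (a - \<eta> j)"
      using concave_kernel_continuous[OF strictly_concave_kernel_imp_concave_kernel[OF kernels[OF j]]]
      by (simp add: continuous_on_eq_continuous_at)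
    moreover have "((\<lambda>h. a - \<eta> j + e * h) \<longlongrightarrow> a - \<eta> j) (at_right 0)"
      by (auto intro!: tendsto_eq_intros)
    ultimately have "((\<lambda>h. K j (a - \<eta> j + e * h)) \<longlongrightarrow> K j (a - \<eta> j)) (at_right 0)"
      by (rule isCont_tendsto_compose)
    then show ?thesis by (rule order_tendstoD) (use finite_at[OF j] in auto)
  qed
  then have "\<forall>\<^sub>F h in at_right 0. \<forall>j\<in>{..n}. - \<infinity> < K j (a - \<eta> j + e * h)"
    by (intro eventually_ball_finite) auto
  then show ?thesis using eventually_at_right_0_less[OF zero_less_one]
  proof eventually_elim
    case (elim h)
    have real: "(\<Sum>j\<le>n. K j (x j)) = ereal (\<Sum>j\<le>n. kr j (x j))"
      if "\<And>j. j \<le> n \<Longrightarrow> K j (x j) \<noteq> - \<infinity>" for x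
    proof -
      have "(\<Sum>j\<le>n. K j (x j)) = (\<Sum>j\<le>n. ereal (kr j (x j)))"
        using that kernels_PInf by (intro sum.cong) (auto simp: ereal_real)
      then show ?thesis by simp
    qed
    have "(\<Sum>j\<le>n. K j (a - \<eta> j + e * h)) \<le> (\<Sum>j\<le>n. K j (a - \<eta> j))"
      using maximal[of "a + e * h"] by (simp add: algebra_simps)
    moreover have "K j (a - \<eta> j + e * h) \<noteq> - \<infinity>" if "j \<le> n" for j using elim that by force
    ultimately have "(\<Sum>j\<le>n. kr j (a - \<eta> j + e * h)) \<le> (\<Sum>j\<le>n. kr j (a - \<eta> j))"
      using finite_at by (simp add: real)
    then show ?case
      using elim by (simp add: divide_le_0_iff flip: sum_divide_distrib sum_subtractf) (simp add: sum_subtractf)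
  qed
qed

text \<open>Adding both directions, maximality makes the summed minorants eventually nonpositive,
  hence also the sum of their limits. These limits are nonnegative, and the one for the kernel
  centred at \<open>a\<close> is positive.\<close>

lemma C1_max_not_node:
  assumes C1: "\<And>j. j \<le> n \<Longrightarrow> kernel_C1 (K j)"
    and i: "i \<le> n" "a - \<eta> i \<in> range (\<lambda>m. 2 * pi * of_int m)"
  shows False
proof -
  let ?q = "\<lambda>e j h. (kr j (a - \<eta> j + e * h) - kr j (a - \<eta> j)) / h"
  define good where "good j w c \<longleftrightarrow> (w \<longlongrightarrow> c) (at_right 0) \<and> 0 \<le> c \<and>
      (a - \<eta> j \<in> range (\<lambda>m. 2 * pi * of_int m) \<longrightarrow> 0 < c) \<and>
      (\<forall>\<^sub>F h in at_right 0. w h \<le> ?q 1 j h + ?q (- 1) j h)" for j w c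
  have "\<forall>j. \<exists>w c. j \<le> n \<longrightarrow> good j w c"
    using kernel_second_quotient[OF kernels C1 finite_at] by (simp add: good_def)
  then obtain w c where good: "\<And>j. j \<le> n \<Longrightarrow> good j (w j) (c j)" by metis
  then have w: "\<And>j. j \<le> n \<Longrightarrow> (w j \<longlongrightarrow> c j) (at_right 0)"
    and c: "\<And>j. j \<le> n \<Longrightarrow> 0 \<le> c j" "\<And>j. j \<le> n \<Longrightarrow> a - \<eta> j \<in> range (\<lambda>m. 2 * pi * of_int m) \<Longrightarrow> 0 < c j"
    and wq: "\<And>j. j \<le> n \<Longrightarrow> \<forall>\<^sub>F h in at_right 0. w j h \<le> ?q 1 j h + ?q (- 1) j h"
    by (auto simp: good_def)
  have "\<forall>\<^sub>F h in at_right 0. \<forall>j\<in>{..n}. w j h \<le> ?q 1 j h + ?q (- 1) j h"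
    using wq by (intro eventually_ball_finite) auto
  then have "\<forall>\<^sub>F h in at_right 0. (\<Sum>j\<le>n. w j h) \<le> 0"
    using sum_quotient_nonpos[OF disjI1[OF refl]] sum_quotient_nonpos[OF disjI2[OF refl]]
  proof eventually_elim
    case (elim h)
    have "(\<Sum>j\<le>n. w j h) \<le> (\<Sum>j\<le>n. ?q 1 j h + ?q (- 1) j h)" using elim(1) by (intro sum_mono) auto
    then show ?case using elim(2,3) unfolding sum.distrib by linarith
  qed
  moreover have "((\<lambda>h. \<Sum>j\<le>n. w j h) \<longlongrightarrow> (\<Sum>j\<le>n. c j)) (at_right 0)"
    using w by (intro tendsto_sum) auto
  ultimately have "(\<Sum>j\<le>n. c j) \<le> 0"
    by (intro tendsto_upperbound) auto
  moreover have "0 < (\<Sum>j\<le>n. c j)"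
    using c i by (intro sum_pos2[of _ i]) auto
  ultimately show False by simp
qed

text \<open>The kernel centred at \<open>a\<close> has a quotient tending to infinity in some
  direction \<open>e\<close>. As either direction may occur, the other quotients are bounded below
  in both, the backward case by reflection.\<close>

lemma cond_infty'_max_not_node:
  assumes cond: "cond_infty' (K i)"
    and i: "i \<le> n" "a - \<eta> i \<in> range (\<lambda>m. 2 * pi * of_int m)"
  shows False
proof -
  let ?q = "\<lambda>e j h. (kr j (a - \<eta> j + e * h) - kr j (a - \<eta> j)) / h"
  obtain m where m: "a - \<eta> i = 2 * pi * of_int m" using i(2) by auto
  have base: "kernel_base (K i)" using kernels[OF i(1)] by (simp add: strictly_concave_kernel_def)
  have shift: "K i (a - \<eta> i + t) = K i t" "K i (a - \<eta> i) = K i 0" for t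
    using kernel_base_plus_int[OF base, of t m] kernel_base_plus_int[OF base, of 0 m]
    by (auto simp: m add.commute)
  have below: "\<exists>C. \<forall>\<^sub>F h in at_right 0. C \<le> ?q e j h" if j: "j \<le> n" and e: "e = 1 \<or> e = -1" for e j
    using e
  proof
    assume "e = 1"
    then show ?thesis using kernel_quotient_bounded_below[OF kernels finite_at, OF j j] by simp
  next
    assume e: "e = -1"
    have "\<exists>C. \<forall>\<^sub>F h in at_right 0. C \<le> (kr j (- (- (a - \<eta> j) + h)) - kr j (- (- (a - \<eta> j)))) / h"
      by (rule kernel_quotient_bounded_below[OF strictly_concave_kernel_reflect[OF kernels[OF j]]])
         (use finite_at[OF j] in simp)
    moreover have "- (- (a - \<eta> j) + h) = a - \<eta> j + e * h" for h by (simp add: e)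
    ultimately show ?thesis by (simp only: minus_minus)
  qed
  have "\<exists>e. (e = 1 \<or> e = -1) \<and> filterlim (?q e i) at_top (at_right 0)"
    using cond_infty'_quotient_at_top[OF strictly_concave_kernel_imp_concave_kernel[OF kernels[OF i(1)]] _ cond]
      finite_at[OF i(1)] shift by auto
  then obtain e where e: "e = 1 \<or> e = -1" and top: "filterlim (?q e i) at_top (at_right 0)" by blast
  show False
    by (rule sum_at_top_not_nonpos[where P = "?q e" and I = "{..n}", OF _ _ top])
       (use below e i sum_quotient_nonpos[OF e] in auto)
qed

end

theorem equioscillation_point_in_open_simplex:
  assumes kernels: "\<And>j. j \<le> n \<Longrightarrow> strictly_concave_kernel (K j)"
    and perm: "\<sigma> permutes {1..n}"
    and cond: "(\<forall>j\<le>n. kernel_C1 (K j)) \<or> card {j. j \<le> n \<and> cond_infty' (K j)} \<ge> n"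
    and equi: "equioscillation_point n K \<sigma> y"
  shows "y \<in> open_simplex n \<sigma>"
proof (rule ccontr)
  define z where "z k = ynode n y (\<sigma> k)" for k
  define \<eta> where "\<eta> j = (if j = 0 then 0 else y j)" for j
  have sot: "sot n K y t = (\<Sum>j\<le>n. K j (t - \<eta> j))" for t
    by (rule sot_eq_sum) (auto simp: \<eta>_def)
  have base: "kernel_base (K j)" if "j \<le> n" for j
    using kernels[OF that] by (simp add: strictly_concave_kernel_def)
  have ends: "z 0 = 0" "z (Suc n) = 2 * pi"
    using permutes_not_in[OF perm] by (auto simp: z_def ynode_def)
  have in_range: "\<sigma> k \<in> {1..n}" if "k \<in> {1..n}" for k
    using perm that by (simp only: permutes_in_image)
  assume "y \<notin> open_simplex n \<sigma>"
  moreover have mono: "z k \<le> z (Suc k)" if "k \<le> n" for k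
    using equi that by (simp add: equioscillation_point_def closed_simplex_def z_def)
  ultimately obtain k where k: "k \<le> n" "z k = z (Suc k)"
    by (force simp: open_simplex_def z_def)
  \<comment> \<open>The two ends of the collapsed interval are centres of the kernels
    \<open>i1\<close> and \<open>i2\<close>. The end node \<open>2 * pi\<close> is 0 on the torus,
    so for \<open>k = n\<close> it belongs to \<open>K 0\<close>, and its offset from
    \<open>a\<close> is then \<open>2 * pi\<close>.\<close>
  define a where "a = z k"
  define i1 where "i1 = \<sigma> k"
  define i2 where "i2 = (if k = n then 0 else \<sigma> (Suc k))"
  \<comment> \<open>For \<open>n = 0\<close> the only interval is the whole period, which is not
    collapsed.\<close>
  have "0 < n" using k ends by (cases n) auto
  have i1: "i1 \<le> n" "a - \<eta> i1 = 0"
    using in_range[of k] k(1) permutes_not_in[OF perm, of 0]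
    by (cases "k = 0"; force simp: i1_def a_def z_def ynode_def \<eta>_def)+
  have i2: "i2 \<le> n" "a - \<eta> i2 \<in> {0, 2 * pi}"
    using in_range[of "Suc k"] k ends
    by (cases "k = n"; force simp: i2_def a_def z_def ynode_def \<eta>_def)+
  have "i1 \<noteq> i2"
  proof (cases "k = n")
    case True
    then show ?thesis using in_range[of n] \<open>0 < n\<close> by (simp add: i1_def i2_def)
  next
    case False
    have "\<sigma> k \<noteq> \<sigma> (Suc k)" using permutes_inj[OF perm] by (metis injD n_not_Suc_n)
    with False show ?thesis by (simp add: i1_def i2_def)
  qed
  have node1: "a - \<eta> i1 \<in> range (\<lambda>m. 2 * pi * of_int m)"
    using i1 by (auto intro!: image_eqI[of _ _ 0])
  have node2: "a - \<eta> i2 \<in> range (\<lambda>m. 2 * pi * of_int m)"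
    using i2(2) by (auto intro: image_eqI[of _ _ 0] image_eqI[of _ _ 1])
  \<comment> \<open>The collapsed interval is the single point \<open>a\<close>, so its maximum is
    the value there, and equioscillation carries this value to every interval.\<close>
  have max_a: "interval_max n K \<sigma> y j = sot n K y a" if "j \<le> n" for j
  proof -
    have "interval_max n K \<sigma> y k = sot n K y a"
      using k(2) by (simp add: interval_max_def a_def z_def)
    then show ?thesis using equi that k(1) unfolding equioscillation_point_def by metis
  qed
  have maximal: "(\<Sum>j\<le>n. K j (t - \<eta> j)) \<le> (\<Sum>j\<le>n. K j (a - \<eta> j))" for t
  proof -
    obtain m c where t: "t = c + 2 * pi * of_int m" and c: "0 \<le> c" "c < 2 * pi"
      by (rule obtain_representative)
    have "(\<Sum>j\<le>n. K j (t - \<eta> j)) = (\<Sum>j\<le>n. K j (c - \<eta> j))"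
    proof (rule sum.cong[OF refl])
      fix j assume "j \<in> {..n}"
      then show "K j (t - \<eta> j) = K j (c - \<eta> j)"
        using kernel_base_plus_int[OF base, of j "c - \<eta> j" m] by (simp add: t algebra_simps)
    qed
    moreover obtain j where "j \<le> n" "z j \<le> c" "c \<le> z (Suc j)"
      using monotone_nodes_cover[of z c n] c ends by auto
    then have "sot n K y c \<le> interval_max n K \<sigma> y j"
      unfolding interval_max_def by (intro SUP_upper) (simp add: z_def)
    ultimately show ?thesis using max_a[OF \<open>j \<le> n\<close>] by (simp add: sot)
  qed
  \<comment> \<open>With \<open>0 < t < 2 * pi\<close> this puts \<open>t - \<eta> j\<close>
    strictly between \<open>-2 * pi\<close> and \<open>2 * pi\<close>, so it avoids the centres as
    soon as it is nonzero.\<close>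
  have \<eta>_range: "0 \<le> \<eta> j" "\<eta> j \<le> 2 * pi" if "j \<le> n" for j
  proof -
    have lower: "0 \<le> z l" if "l \<le> Suc n" for l
      using that mono ends(1) by (induction l) (auto intro: order_trans)
    have upper: "z l \<le> 2 * pi" if "l \<le> Suc n" for l
      using that by (induction rule: inc_induct) (use mono ends(2) in \<open>auto intro!: order_trans[OF mono]\<close>)
    have "\<eta> j \<in> z ` {..n}"
    proof (cases "j = 0")
      case True
      then show ?thesis using ends by (auto simp: \<eta>_def)
    next
      case False
      then have "j \<in> {1..n}" using \<open>j \<le> n\<close> by simp
      then obtain l where "l \<in> {1..n}" "\<sigma> l = j" using permutes_image[OF perm] by (metis imageE)
      then show ?thesis using False \<open>j \<le> n\<close> by (auto simp: z_def ynode_def \<eta>_def intro!: image_eqI[of _ _ l])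
    qed
    then show "0 \<le> \<eta> j" "\<eta> j \<le> 2 * pi" using lower upper by auto
  qed
  have PInf: "K j s \<noteq> \<infinity>" if "j \<le> n" for j s
    using base[OF that] by (simp add: kernel_base_def)
  \<comment> \<open>A point \<open>t\<close> of the open period away from the finitely many nodes
    has finite sum, so the maximum at \<open>a\<close> is finite and with it each of its
    terms.\<close>
  have "infinite {0<..<2 * pi}" by (simp add: infinite_Ioo)
  then obtain t where t: "t \<in> {0<..<2 * pi}" "t \<notin> \<eta> ` {..n}"
    by (metis finite_atMost finite_imageI finite_subset subsetI)
  have "K j (t - \<eta> j) \<noteq> - \<infinity>" if j: "j \<le> n" for j
  proof -
    have ne: "t \<noteq> \<eta> j" using t(2) j by auto
    have "K j s \<noteq> - \<infinity>" if "s \<in> {0<..<2 * pi}" for s using base[OF j] that by (simp add: kernel_base_def)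
    from this[of "t - \<eta> j"] this[of "t - \<eta> j + 2 * pi"] show ?thesis
      using base[OF j] ne t(1) \<eta>_range[OF j] by (cases "\<eta> j < t") (auto simp: kernel_base_def)
  qed
  then have "(\<Sum>j\<le>n. K j (t - \<eta> j)) \<noteq> - \<infinity>"
    using PInf by (subst sum_ereal_eq_MInf) auto
  then have fin: "(\<Sum>j\<le>n. K j (a - \<eta> j)) \<noteq> - \<infinity>" using maximal[of t] by auto
  have finite_at: "K j (a - \<eta> j) \<noteq> - \<infinity>" if "j \<le> n" for j
    using fin PInf that by (subst (asm) sum_ereal_eq_MInf) auto
  from cond show False
  proof
    assume "\<forall>j\<le>n. kernel_C1 (K j)"
    then show False using C1_max_not_node[of n K a \<eta> i1] kernels finite_at maximal i1(1) node1 by blast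
  next
    assume card: "card {j. j \<le> n \<and> cond_infty' (K j)} \<ge> n"
    \<comment> \<open>Pigeonhole: at most one of the \<open>n + 1\<close> kernels violates the
      condition, and \<open>i1\<close> and \<open>i2\<close> are distinct.\<close>
    have "cond_infty' (K i1) \<or> cond_infty' (K i2)"
    proof (rule ccontr)
      assume "\<not> ?thesis"
      then have "{j. j \<le> n \<and> cond_infty' (K j)} \<subseteq> {..n} - {i1, i2}" by auto
      then have "card {j. j \<le> n \<and> cond_infty' (K j)} \<le> card ({..n} - {i1, i2})" by (intro card_mono) auto
      also have "\<dots> = n - 1" using i1(1) i2(1) \<open>i1 \<noteq> i2\<close> by (simp add: card_Diff_subset)
      finally show False using card \<open>0 < n\<close> by simp
    qed
    then show False
      using cond_infty'_max_not_node[of n K a \<eta> i1] cond_infty'_max_not_node[of n K a \<eta> i2]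
        kernels finite_at maximal i1(1) node1 i2(1) node2 by blast
  qed
qed

theorem theorem10p4:
  fixes n :: nat and K :: "nat \<Rightarrow> real \<Rightarrow> ereal" and \<sigma> :: "nat \<Rightarrow> nat"
  assumes kernels: "\<And>j. j \<le> n \<Longrightarrow> strictly_concave_kernel (K j)"
    and perm: "\<sigma> permutes {1..n}"
  shows "(\<exists>y. equioscillation_point n K \<sigma> y)
    \<and> (((\<forall>j\<le>n. kernel_C1 (K j)) \<or> card {j. j \<le> n \<and> cond_infty' (K j)} \<ge> n) \<longrightarrow>
         (\<forall>y. equioscillation_point n K \<sigma> y \<longrightarrow> y \<in> open_simplex n \<sigma>))"
proof -
  have "\<exists>y. equioscillation_point n K \<sigma> y"
    by (rule equioscillation_point_exists[OF _ perm])
       (use kernels strictly_concave_kernel_imp_concave_kernel in blast)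
  moreover have "y \<in> open_simplex n \<sigma>"
    if "(\<forall>j\<le>n. kernel_C1 (K j)) \<or> card {j. j \<le> n \<and> cond_infty' (K j)} \<ge> n"
      "equioscillation_point n K \<sigma> y" for y
    using that kernels by (intro equioscillation_point_in_open_simplex[OF _ perm])
  ultimately show ?thesis by blast
qed

end
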